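(* Let $A,B\in\mathcal{H}_n(\Gamma)$ with $B\in\mathcal{M}(A)$ (that is, $G_A=G_B$). Then the gain graphs $G_A^\zeta$ and $G_B^\zeta$ are switching isomorphic if and only if $[A]$ and $[B]$ belong to the same orbit of $\Omega_{\mathcal{M}}(A)$ under the action of $\mathrm{Aut}(G_A)$.
   Context: $\Gamma\subset\mathbb{C}$ is a set such that $0\in\Gamma$ and $\Gamma\setminus\{0\}$ is a subgroup of the multiplicative group of complex numbers of unit modulus. $\mathcal{H}_n(\Gamma)$ is the set of all $n\times n$ Hermitian matrices with entries in $\Gamma$ and zero diagonal. For $A=[a_{uv}]\in\mathcal{H}_n(\Gamma)$, $G_A$ is the simple undirected graph on $\{1,\dots,n\}$ in which $u,v$ are adjacent iff $a_{uv}\ne0$, and the gain graph $G_A^\zeta$ is $G_A$ with the gain $a_{uv}$ on the edge $(u,v)$. Matrices $A,B\in\mathcal{H}_n(\Gamma)$ are switching equivalent, $A\sim B$, if $D^{-1}AD=B$ for some diagonal matrix $D$ with diagonal entries in $\Gamma\setminus\{0\}$. Gain graphs $G_A^\zeta$ and $G_B^\zeta$ are isomorphic if there is a bijection $f$ of $\{1,\dots,n\}$ with $b_{f(i)f(j)}=a_{ij}$ for all $i,j$. They are switching isomorphic if $G_A^\zeta$ is isomorphic to a gain graph $G_C^\zeta$ with $C\in\mathcal{H}_n(\Gamma)$ switching equivalent to $B$; equivalently, $A=(DP)^{-1}B(DP)$ for some permutation matrix $P$ and diagonal matrix $D$ with diagonal entries in $\Gamma\setminus\{0\}$. For $A\in\mathcal{H}_n(\Gamma)$,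 $\mathcal{M}(A)=\{B\in\mathcal{H}_n(\Gamma):G_A=G_B\}$; for $B\in\mathcal{M}(A)$, $[B]=\{X\in\mathcal{M}(A):X\sim B\}$; and $\Omega_{\mathcal{M}}(A)=\{[B]:B\in\mathcal{M}(A)\}$. $\mathrm{Aut}(G_A)$ is the automorphism group of the undirected graph $G_A$. For $f\in\mathrm{Aut}(G_A)$ and $B=[b_{uv}]\in\mathcal{M}(A)$, $f(B)$ is the matrix whose $(u,v)$ entry is $b_{f(u)f(v)}$; this induces a well-defined action $[B]\mapsto[f(B)]$ of $\mathrm{Aut}(G_A)$ on $\Omega_{\mathcal{M}}(A)$, and two classes $[B],[C]$ are in the same orbit iff $[f(B)]=[C]$ for some $f\in\mathrm{Aut}(G_A)$. *)

theory Defs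
  imports "HOL-Analysis.Analysis" "HOL-Algebra.Group_Action"
begin

text \<open>
  An \<open>n \<times> n\<close> matrix is a \<^typ>\<open>complex^'n^'n\<close>: the arbitrary finite type \<open>'n\<close>
  plays the role of the index set \<open>{1, \<dots>, n}\<close>.
\<close>

section \<open>The matrices\<close>

definition circle_group :: "complex monoid" where
  "circle_group = \<lparr>carrier = {z. norm z = 1}, monoid.mult = (*), one = 1\<rparr>"

definition gain_set :: "complex set \<Rightarrow> bool" where
  "gain_set \<Gamma> \<longleftrightarrow> 0 \<in> \<Gamma> \<and> subgroup (\<Gamma> - {0}) circle_group"

definition hermitian :: "complex^'n^'n \<Rightarrow> bool" where
  "hermitian A \<longleftrightarrow> (\<forall>u v. A $ v $ u = cnj (A $ u $ v))"

definition Herm :: "complex set \<Rightarrow> (complex^'n^'n) set" where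
  "Herm \<Gamma> = {A. hermitian A \<and> (\<forall>u v. A $ u $ v \<in> \<Gamma>) \<and> (\<forall>u. A $ u $ u = 0)}"

definition gain_diagonal :: "complex set \<Rightarrow> complex^'n^'n \<Rightarrow> bool" where
  "gain_diagonal \<Gamma> D \<longleftrightarrow>
     (\<forall>u v. u \<noteq> v \<longrightarrow> D $ u $ v = 0) \<and> (\<forall>u. D $ u $ u \<in> \<Gamma> - {0})"

definition switching_equivalent :: "complex set \<Rightarrow> complex^'n^'n \<Rightarrow> complex^'n^'n \<Rightarrow> bool" where
  "switching_equivalent \<Gamma> A B \<longleftrightarrow> (\<exists>D. gain_diagonal \<Gamma> D \<and> matrix_inv D ** A ** D = B)"

section \<open>Graphs and gain graphs\<close>

text \<open>A simple undirected graph is a pair of a vertex set and a set of edges \<open>{u, v}\<close>.\<close>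

type_synonym 'v ugraph = "'v set \<times> 'v set set"

definition graph_of :: "complex^'n^'n \<Rightarrow> 'n ugraph" where
  "graph_of A = (UNIV, {{u, v} | u v. A $ u $ v \<noteq> 0})"

text \<open>
  A gain graph is a graph with a gain for each oriented edge; the gain function is
  extended by \<open>0\<close> to pairs of non-adjacent vertices. A bijection preserving the extended
  gains therefore preserves adjacency as well.
\<close>

type_synonym 'v gain_graph = "'v ugraph \<times> ('v \<Rightarrow> 'v \<Rightarrow> complex)"

definition gain_graph_of :: "complex^'n^'n \<Rightarrow> 'n gain_graph" where
  "gain_graph_of A = (graph_of A, \<lambda>u v. A $ u $ v)"

definition gain_graph_isomorphic :: "'v gain_graph \<Rightarrow> 'w gain_graph \<Rightarrow> bool" where
  "gain_graph_isomorphic = (\<lambda>((V, E), \<phi>) ((W, F), \<psi>).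
     \<exists>f. bij_betw f V W \<and> (\<forall>i\<in>V. \<forall>j\<in>V. \<psi> (f i) (f j) = \<phi> i j))"

text \<open>The arguments are matrices \<open>A\<close>, \<open>B\<close>; the notion is about their gain graphs.\<close>

definition switching_isomorphic :: "complex set \<Rightarrow> complex^'n^'n \<Rightarrow> complex^'n^'n \<Rightarrow> bool" where
  "switching_isomorphic \<Gamma> A B \<longleftrightarrow>
     (\<exists>C\<in>Herm \<Gamma>. switching_equivalent \<Gamma> C B \<and>
        gain_graph_isomorphic (gain_graph_of A) (gain_graph_of C))"

section \<open>Switching classes over a fixed graph\<close>

definition same_graph :: "complex set \<Rightarrow> complex^'n^'n \<Rightarrow> (complex^'n^'n) set" where
  "same_graph \<Gamma> A = {B \<in> Herm \<Gamma>. graph_of A = graph_of B}"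

definition switching_class ::
    "complex set \<Rightarrow> complex^'n^'n \<Rightarrow> complex^'n^'n \<Rightarrow> (complex^'n^'n) set" where
  "switching_class \<Gamma> A B = {X \<in> same_graph \<Gamma> A. switching_equivalent \<Gamma> X B}"

definition switching_classes :: "complex set \<Rightarrow> complex^'n^'n \<Rightarrow> (complex^'n^'n) set set" where
  "switching_classes \<Gamma> A = switching_class \<Gamma> A ` same_graph \<Gamma> A"

section \<open>The action of the automorphism group\<close>

text \<open>
  The map \<open>(f, B) \<mapsto> f(B)\<close> below satisfies \<open>f(g(B)) = (g \<circ> f)(B)\<close>. For it to be an action
  in the (left) sense of \<^locale>\<open>group_action\<close>, the product of \<open>f\<close> and \<open>g\<close> in the
  automorphism group is taken to be \<open>g \<circ> f\<close>; this choice has no influence on the orbits.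
\<close>

definition Aut :: "'v ugraph \<Rightarrow> ('v \<Rightarrow> 'v) monoid" where
  "Aut = (\<lambda>(V, E).
     \<lparr>carrier = {f \<in> Bij V. \<forall>u\<in>V. \<forall>v\<in>V. {f u, f v} \<in> E \<longleftrightarrow> {u, v} \<in> E},
      monoid.mult = \<lambda>f g. compose V g f,
      one = \<lambda>v\<in>V. v\<rparr>)"

definition relabel :: "('n \<Rightarrow> 'n) \<Rightarrow> complex^'n^'n \<Rightarrow> complex^'n^'n" where
  "relabel f B = (\<chi> u v. B $ f u $ f v)"

text \<open>
  The induced map \<open>[B] \<mapsto> [f(B)]\<close>: the union runs over all representatives of the class
  and has a single value, see \<open>class_action_eq\<close> below.
\<close>

definition class_action ::
    "complex set \<Rightarrow> complex^'n^'n \<Rightarrow> ('n \<Rightarrow> 'n) \<Rightarrow> (complex^'n^'n) set \<Rightarrow> (complex^'n^'n) set" where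
  "class_action \<Gamma> A f =
     (\<lambda>K \<in> switching_classes \<Gamma> A. \<Union>X\<in>K. switching_class \<Gamma> A (relabel f X))"

section \<open>Well-definedness of the action\<close>

lemma gain_setD:
  assumes "gain_set \<Gamma>"
  shows "1 \<in> \<Gamma> - {0}"
    and "x \<in> \<Gamma> - {0} \<Longrightarrow> y \<in> \<Gamma> - {0} \<Longrightarrow> x * y \<in> \<Gamma> - {0}"
    and "x \<in> \<Gamma> - {0} \<Longrightarrow> inverse x \<in> \<Gamma> - {0}"
proof -
  have s: "subgroup (\<Gamma> - {0}) circle_group"
    using assms by (simp add: gain_set_def)
  show "1 \<in> \<Gamma> - {0}"
    using subgroup.one_closed[OF s] by (simp add: circle_group_def)
  show "x \<in> \<Gamma> - {0} \<Longrightarrow> y \<in> \<Gamma> - {0} \<Longrightarrow> x * y \<in> \<Gamma> - {0}"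
    using subgroup.m_closed[OF s] by (simp add: circle_group_def)
  assume x: "x \<in> \<Gamma> - {0}"
  have g: "group circle_group"
  proof (rule groupI)
    fix z assume "z \<in> carrier circle_group"
    then show "\<exists>y\<in>carrier circle_group. y \<otimes>\<^bsub>circle_group\<^esub> z = \<one>\<^bsub>circle_group\<^esub>"
      by (intro bexI[of _ "inverse z"])
        (auto simp: circle_group_def norm_inverse intro!: left_inverse)
  qed (auto simp: circle_group_def norm_mult)
  have xc: "x \<in> carrier circle_group"
    using subgroup.subset[OF s] x by blast
  have "inv\<^bsub>circle_group\<^esub> x \<otimes>\<^bsub>circle_group\<^esub> x = \<one>\<^bsub>circle_group\<^esub>"
    using group.l_inv[OF g xc] .
  then have "inv\<^bsub>circle_group\<^esub> x * x = 1"
    by (simp add: circle_group_def)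
  then have "inv\<^bsub>circle_group\<^esub> x = inverse x"
    using x by (simp add: field_simps)
  then show "inverse x \<in> \<Gamma> - {0}"
    using subgroup.m_inv_closed[OF s x] by simp
qed

lemma diagonal_conj:
  fixes D A :: "complex^'n^'n"
  assumes "gain_diagonal \<Gamma> D"
  shows "(matrix_inv D ** A ** D) $ i $ j = inverse (D $ i $ i) * A $ i $ j * D $ j $ j"
proof -
  have off: "D $ u $ v = 0" if "u \<noteq> v" for u v
    using assms that by (simp add: gain_diagonal_def)
  have nz: "D $ u $ u \<noteq> 0" for u
    using assms by (simp add: gain_diagonal_def)
  define E :: "complex^'n^'n" where "E = (\<chi> u v. if u = v then inverse (D $ u $ u) else 0)"
  have r: "(M ** D) $ i $ j = M $ i $ j * D $ j $ j" for M :: "complex^'n^'n" and i j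
    unfolding matrix_matrix_mult_def
    by simp (subst sum.remove[of _ j], auto simp: off intro!: sum.neutral)
  have l: "(E ** M) $ i $ j = inverse (D $ i $ i) * M $ i $ j" for M :: "complex^'n^'n" and i j
    unfolding matrix_matrix_mult_def E_def
    by simp (subst sum.remove[of _ i], auto intro!: sum.neutral)
  have 1: "E ** D = mat 1"
    by (simp add: vec_eq_iff l mat_def off nz)
  have 2: "D ** E = mat 1"
    using 1 matrix_left_right_inverse by blast
  have "D ** matrix_inv D = mat 1 \<and> matrix_inv D ** D = mat 1"
    unfolding matrix_inv_def by (rule someI[of _ E]) (use 1 2 in blast)
  then have "matrix_inv D = E"
    by (metis 1 matrix_mul_assoc matrix_mul_lid matrix_mul_rid)
  then show ?thesis
    by (simp add: r l)
qed

lemma switching_equivalent_iff: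
  fixes A B :: "complex^'n^'n"
  shows "switching_equivalent \<Gamma> A B \<longleftrightarrow>
    (\<exists>d. (\<forall>i. d i \<in> \<Gamma> - {0}) \<and> (\<forall>i j. B $ i $ j = inverse (d i) * A $ i $ j * d j))"
    (is "?l \<longleftrightarrow> ?r")
proof
  assume ?l
  then obtain D where D: "gain_diagonal \<Gamma> D" "matrix_inv D ** A ** D = B"
    by (auto simp: switching_equivalent_def)
  then show ?r
    using diagonal_conj[OF D(1), of A]
    by (intro exI[of _ "\<lambda>i. D $ i $ i"]) (auto simp: gain_diagonal_def)
next
  assume ?r
  then obtain d where d: "\<forall>i. d i \<in> \<Gamma> - {0}"
    "\<forall>i j. B $ i $ j = inverse (d i) * A $ i $ j * d j"
    by blast
  define D :: "complex^'n^'n" where "D = (\<chi> i j. if i = j then d i else 0)"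
  have D: "gain_diagonal \<Gamma> D"
    using d(1) by (simp add: gain_diagonal_def D_def)
  have "matrix_inv D ** A ** D = B"
    using d(2) by (simp add: vec_eq_iff diagonal_conj[OF D]) (simp add: D_def)
  with D show ?l
    by (auto simp: switching_equivalent_def)
qed

lemma switching_equivalent_refl:
  assumes "gain_set \<Gamma>"
  shows "switching_equivalent \<Gamma> A A"
  unfolding switching_equivalent_iff
  using gain_setD(1)[OF assms] by (intro exI[of _ "\<lambda>_. 1"]) simp

lemma switching_equivalent_sym:
  assumes "gain_set \<Gamma>" "switching_equivalent \<Gamma> A B"
  shows "switching_equivalent \<Gamma> B A"
proof -
  obtain d where d: "\<And>i. d i \<in> \<Gamma> - {0}"
    "\<And>i j. B $ i $ j = inverse (d i) * A $ i $ j * d j"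
    using assms(2) by (auto simp: switching_equivalent_iff)
  have "d i \<noteq> 0" for i
    using d(1)[of i] by simp
  then show ?thesis
    unfolding switching_equivalent_iff using gain_setD(3)[OF assms(1) d(1)]
    by (intro exI[of _ "\<lambda>i. inverse (d i)"]) (simp add: d(2) field_simps)
qed

lemma switching_equivalent_trans:
  assumes "gain_set \<Gamma>" "switching_equivalent \<Gamma> A B" "switching_equivalent \<Gamma> B C"
  shows "switching_equivalent \<Gamma> A C"
proof -
  obtain d where d: "\<And>i. d i \<in> \<Gamma> - {0}"
    "\<And>i j. B $ i $ j = inverse (d i) * A $ i $ j * d j"
    using assms(2) by (auto simp: switching_equivalent_iff)
  obtain e where e: "\<And>i. e i \<in> \<Gamma> - {0}"
    "\<And>i j. C $ i $ j = inverse (e i) * B $ i $ j * e j"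
    using assms(3) by (auto simp: switching_equivalent_iff)
  show ?thesis
    unfolding switching_equivalent_iff using gain_setD(2)[OF assms(1) d(1) e(1)]
    by (intro exI[of _ "\<lambda>i. d i * e i"]) (simp add: d(2) e(2) mult_ac)
qed

lemma switching_class_eq:
  assumes "gain_set \<Gamma>" "switching_equivalent \<Gamma> X Y"
  shows "switching_class \<Gamma> A X = switching_class \<Gamma> A Y"
  using switching_equivalent_trans[OF assms(1) _ assms(2)]
    switching_equivalent_trans[OF assms(1) _ switching_equivalent_sym[OF assms]]
  unfolding switching_class_def by blast

lemma edge_graph_of:
  assumes "hermitian A"
  shows "{u, v} \<in> snd (graph_of A) \<longleftrightarrow> A $ u $ v \<noteq> 0"
proof -
  have "A $ v $ u = 0 \<longleftrightarrow> A $ u $ v = 0"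
    by (metis assms hermitian_def complex_cnj_zero_iff)
  then show ?thesis
    by (auto simp: graph_of_def doubleton_eq_iff)
qed

lemma graph_of_eq_iff:
  assumes "hermitian A" "hermitian B"
  shows "graph_of A = graph_of B \<longleftrightarrow> (\<forall>u v. A $ u $ v = 0 \<longleftrightarrow> B $ u $ v = 0)"
proof
  assume "graph_of A = graph_of B"
  then show "\<forall>u v. A $ u $ v = 0 \<longleftrightarrow> B $ u $ v = 0"
    using edge_graph_of[OF assms(1)] edge_graph_of[OF assms(2)] by metis
qed (simp add: graph_of_def)

lemma carrier_Aut_graph_of:
  assumes "hermitian A"
  shows "f \<in> carrier (Aut (graph_of A)) \<longleftrightarrow>
    bij f \<and> (\<forall>u v. A $ f u $ f v = 0 \<longleftrightarrow> A $ u $ v = 0)"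
  using edge_graph_of[OF assms] by (auto simp: Aut_def graph_of_def Bij_def)

lemma relabel_same_graph:
  assumes "A \<in> Herm \<Gamma>" "f \<in> carrier (Aut (graph_of A))" "B \<in> same_graph \<Gamma> A"
  shows "relabel f B \<in> same_graph \<Gamma> A"
proof -
  have A: "hermitian A" and B: "B \<in> Herm \<Gamma>" "hermitian B" "graph_of A = graph_of B"
    using assms by (auto simp: Herm_def same_graph_def)
  have C: "relabel f B \<in> Herm \<Gamma>"
    using B(1) unfolding Herm_def relabel_def hermitian_def mem_Collect_eq vec_lambda_beta by blast
  then have h: "hermitian (relabel f B)"
    by (simp add: Herm_def)
  have z: "B $ u $ v = 0 \<longleftrightarrow> A $ u $ v = 0" for u v
    using B(3) graph_of_eq_iff[OF A B(2)] by blast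
  have "A $ f u $ f v = 0 \<longleftrightarrow> A $ u $ v = 0" for u v
    using assms(2) carrier_Aut_graph_of[OF A] by blast
  then have "graph_of A = graph_of (relabel f B)"
    unfolding graph_of_eq_iff[OF A h] by (simp add: relabel_def z)
  with C show ?thesis
    by (simp add: same_graph_def)
qed

lemma relabel_switching_equivalent:
  assumes "switching_equivalent \<Gamma> X Y"
  shows "switching_equivalent \<Gamma> (relabel f X) (relabel f Y)"
proof -
  obtain d where d: "\<And>i. d i \<in> \<Gamma> - {0}"
    "\<And>i j. Y $ i $ j = inverse (d i) * X $ i $ j * d j"
    using assms by (auto simp: switching_equivalent_iff)
  then show ?thesis
    unfolding switching_equivalent_iff
    by (intro exI[of _ "d \<circ> f"]) (simp add: relabel_def)
qed

lemma class_action_eq: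
  assumes "gain_set \<Gamma>" "B \<in> same_graph \<Gamma> A"
  shows "class_action \<Gamma> A f (switching_class \<Gamma> A B) = switching_class \<Gamma> A (relabel f B)"
proof -
  have "switching_class \<Gamma> A (relabel f X) = switching_class \<Gamma> A (relabel f B)"
    if "X \<in> switching_class \<Gamma> A B" for X
    using that assms(1)
    by (intro switching_class_eq relabel_switching_equivalent) (auto simp: switching_class_def)
  moreover have "B \<in> switching_class \<Gamma> A B"
    using assms switching_equivalent_refl by (auto simp: switching_class_def)
  ultimately have "(\<Union>X\<in>switching_class \<Gamma> A B. switching_class \<Gamma> A (relabel f X)) =
      switching_class \<Gamma> A (relabel f B)"
    by blast
  then show ?thesis
    using assms(2) by (simp add: class_action_def switching_classes_def)
qed

lemma group_Aut_graph_of: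
  fixes A :: "complex^'n^'n"
  assumes "hermitian A"
  shows "group (Aut (graph_of A))"
proof (rule groupI)
  note carr = carrier_Aut_graph_of[OF assms]
  have m: "f \<otimes>\<^bsub>Aut (graph_of A)\<^esub> g = g \<circ> f" for f g
    by (auto simp: Aut_def graph_of_def compose_def)
  have o: "\<one>\<^bsub>Aut (graph_of A)\<^esub> = id"
    by (auto simp: Aut_def graph_of_def)
  show "f \<otimes>\<^bsub>Aut (graph_of A)\<^esub> g \<in> carrier (Aut (graph_of A))"
    if "f \<in> carrier (Aut (graph_of A))" "g \<in> carrier (Aut (graph_of A))" for f g
    using that unfolding m carr by (auto intro: bij_comp)
  show "\<one>\<^bsub>Aut (graph_of A)\<^esub> \<in> carrier (Aut (graph_of A))"
    unfolding o carr by auto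
  show "f \<otimes>\<^bsub>Aut (graph_of A)\<^esub> g \<otimes>\<^bsub>Aut (graph_of A)\<^esub> h =
      f \<otimes>\<^bsub>Aut (graph_of A)\<^esub> (g \<otimes>\<^bsub>Aut (graph_of A)\<^esub> h)" for f g h
    by (simp add: m o_assoc)
  show "\<one>\<^bsub>Aut (graph_of A)\<^esub> \<otimes>\<^bsub>Aut (graph_of A)\<^esub> f = f" for f
    by (simp add: m o)
  show "\<exists>g\<in>carrier (Aut (graph_of A)). g \<otimes>\<^bsub>Aut (graph_of A)\<^esub> f = \<one>\<^bsub>Aut (graph_of A)\<^esub>"
    if f: "f \<in> carrier (Aut (graph_of A))" for f
  proof
    have b: "bij f"
      using f by (simp add: carr)
    show "inv_into UNIV f \<otimes>\<^bsub>Aut (graph_of A)\<^esub> f = \<one>\<^bsub>Aut (graph_of A)\<^esub>"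
      using b by (auto simp: m o bij_is_surj surj_f_inv_f)
    have "A $ inv_into UNIV f u $ inv_into UNIV f v = 0 \<longleftrightarrow> A $ u $ v = 0" for u v
      using f by (metis b bij_is_surj carr surj_f_inv_f)
    with b show "inv_into UNIV f \<in> carrier (Aut (graph_of A))"
      by (simp add: carr bij_imp_bij_inv)
  qed
qed

theorem group_action_class_action:
  fixes A :: "complex^'n^'n"
  assumes \<Gamma>: "gain_set \<Gamma>" and A: "A \<in> Herm \<Gamma>"
  shows "group_action (Aut (graph_of A)) (switching_classes \<Gamma> A) (class_action \<Gamma> A)"
proof -
  let ?G = "Aut (graph_of A)" and ?O = "switching_classes \<Gamma> A" and ?\<phi> = "class_action \<Gamma> A"
  have hA: "hermitian A"
    using A by (simp add: Herm_def)
  interpret G: group ?G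
    using group_Aut_graph_of[OF hA] .
  have m: "f \<otimes>\<^bsub>?G\<^esub> g = g \<circ> f" for f g
    by (auto simp: Aut_def graph_of_def compose_def)
  have o: "\<one>\<^bsub>?G\<^esub> = id"
    by (auto simp: Aut_def graph_of_def)
  have ext: "?\<phi> f \<in> extensional ?O" for f
    by (simp add: class_action_def)
  have into: "?\<phi> f K \<in> ?O" if "f \<in> carrier ?G" "K \<in> ?O" for f K
    using that(2) relabel_same_graph[OF A that(1)]
    by (auto simp: switching_classes_def class_action_eq[OF \<Gamma>])
  have comp: "?\<phi> (f \<otimes>\<^bsub>?G\<^esub> g) K = ?\<phi> f (?\<phi> g K)"
    if fg: "f \<in> carrier ?G" "g \<in> carrier ?G" and K: "K \<in> ?O" for f g K
  proof -
    obtain B where B: "B \<in> same_graph \<Gamma> A" "K = switching_class \<Gamma> A B"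
      using K by (auto simp: switching_classes_def)
    have "relabel (f \<otimes>\<^bsub>?G\<^esub> g) B = relabel f (relabel g B)"
      by (simp add: relabel_def m vec_eq_iff)
    then show ?thesis
      using B relabel_same_graph[OF A fg(2) B(1)] by (simp add: class_action_eq[OF \<Gamma>])
  qed
  have unit: "?\<phi> \<one>\<^bsub>?G\<^esub> K = K" if K: "K \<in> ?O" for K
  proof -
    obtain B where B: "B \<in> same_graph \<Gamma> A" "K = switching_class \<Gamma> A B"
      using K by (auto simp: switching_classes_def)
    have "relabel \<one>\<^bsub>?G\<^esub> B = B"
      by (simp add: relabel_def o vec_eq_iff)
    then show ?thesis
      using B by (simp add: class_action_eq[OF \<Gamma>])
  qed
  have bij: "?\<phi> f \<in> Bij ?O" if f: "f \<in> carrier ?G" for f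
  proof -
    have i: "inv\<^bsub>?G\<^esub> f \<in> carrier ?G"
      using f by simp
    have "bij_betw (?\<phi> f) ?O ?O"
    proof (rule bij_betwI[where g = "?\<phi> (inv\<^bsub>?G\<^esub> f)"])
      show "?\<phi> (inv\<^bsub>?G\<^esub> f) (?\<phi> f K) = K" if "K \<in> ?O" for K
        using comp[OF i f that] unit[OF that] f by simp
      show "?\<phi> f (?\<phi> (inv\<^bsub>?G\<^esub> f) K) = K" if "K \<in> ?O" for K
        using comp[OF f i that] unit[OF that] f by simp
    qed (use into f i in auto)
    then show ?thesis
      using ext by (simp add: Bij_def)
  qed
  have "?\<phi> (f \<otimes>\<^bsub>?G\<^esub> g) = ?\<phi> f \<otimes>\<^bsub>BijGroup ?O\<^esub> ?\<phi> g"
    if "f \<in> carrier ?G" "g \<in> carrier ?G" for f g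
  proof -
    have "?\<phi> (f \<otimes>\<^bsub>?G\<^esub> g) = compose ?O (?\<phi> f) (?\<phi> g)"
      by (rule extensionalityI[OF ext]) (simp_all add: comp that compose_eq)
    then show ?thesis
      using that by (simp add: BijGroup_def bij)
  qed
  then have "?\<phi> \<in> hom ?G (BijGroup ?O)"
    by (intro homI) (simp_all add: bij BijGroup_def)
  then show ?thesis
    by (intro group_action.intro group_hom.intro group_hom_axioms.intro
        G.group_axioms group_BijGroup)
qed

end

theory Submission
  imports Defs
begin

text \<open>
  Eliminating the intermediate matrix from the definition of a switching isomorphism leaves the
  condition that \<open>A \<sim> f(B)\<close> for some bijection \<open>f\<close> of the vertices
  (\<open>switching_isomorphic_iff_relabel\<close>): an isomorphism onto \<open>G\<^sub>C\<^sup>\<zeta>\<close> along \<open>f\<close> says \<open>f(C) = A\<close>, and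
  relabelling along \<open>f\<close> carries \<open>C \<sim> B\<close> to \<open>A \<sim> f(B)\<close> and back. On the other side, \<open>[A]\<close> and
  \<open>[B]\<close> share an orbit iff \<open>[A] = [f(B)]\<close>, again \<open>A \<sim> f(B)\<close>, for some automorphism \<open>f\<close> of \<open>G\<^sub>A\<close>.

  The two conditions differ only in the range of \<open>f\<close>, and this difference disappears because
  switching multiplies entries by non-zero numbers and so preserves the underlying graph:
  if \<open>A \<sim> f(B)\<close>, then \<open>f\<close> is an isomorphism from \<open>G\<^sub>A\<close> to \<open>G\<^sub>B = G\<^sub>A\<close>
  (\<open>switching_equivalent_relabel_imp_Aut\<close>).
\<close>

lemma relabel_relabel: "relabel f (relabel g B) = relabel (g \<circ> f) B"
  by (simp add: relabel_def vec_eq_iff)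

lemma relabel_id: "relabel id B = B"
  by (simp add: relabel_def vec_eq_iff)

lemma relabel_Herm:
  assumes "A \<in> Herm \<Gamma>"
  shows "relabel f A \<in> Herm \<Gamma>"
  using assms unfolding Herm_def relabel_def hermitian_def mem_Collect_eq vec_lambda_beta by blast

lemma gain_graph_isomorphic_iff_relabel:
  "gain_graph_isomorphic (gain_graph_of A) (gain_graph_of C) \<longleftrightarrow> (\<exists>f. bij f \<and> relabel f C = A)"
  by (simp add: gain_graph_isomorphic_def gain_graph_of_def graph_of_def relabel_def vec_eq_iff)

text \<open>
  The intermediate matrix \<open>C\<close> is determined by \<open>A\<close> and the isomorphism \<open>f\<close>: it is \<open>A\<close> relabelled
  along the inverse of \<open>f\<close>.
\<close>

lemma switching_isomorphic_iff_relabel: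
  assumes "A \<in> Herm \<Gamma>"
  shows "switching_isomorphic \<Gamma> A B \<longleftrightarrow> (\<exists>f. bij f \<and> switching_equivalent \<Gamma> A (relabel f B))"
    (is "?l \<longleftrightarrow> ?r")
proof
  assume ?l
  then obtain C f where "switching_equivalent \<Gamma> C B" "bij f" "relabel f C = A"
    unfolding switching_isomorphic_def gain_graph_isomorphic_iff_relabel by blast
  then show ?r
    using relabel_switching_equivalent by blast
next
  assume ?r
  then obtain f where f: "bij f" and sw: "switching_equivalent \<Gamma> A (relabel f B)"
    by blast
  let ?g = "inv_into UNIV f"
  have "relabel ?g (relabel f B) = B"
    using f by (simp add: relabel_relabel relabel_id bij_is_surj surj_iff[THEN iffD1])
  then have "switching_equivalent \<Gamma> (relabel ?g A) B"
    using relabel_switching_equivalent[OF sw, of ?g] by simp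
  moreover have "relabel f (relabel ?g A) = A"
    using f by (simp add: relabel_relabel relabel_id bij_is_inj)
  ultimately show ?l
    unfolding switching_isomorphic_def gain_graph_isomorphic_iff_relabel
    using relabel_Herm[OF assms] f by blast
qed

lemma switching_equivalent_zero_iff:
  assumes "switching_equivalent \<Gamma> A B"
  shows "A $ u $ v = 0 \<longleftrightarrow> B $ u $ v = 0"
  using assms unfolding switching_equivalent_iff by force

lemma switching_equivalent_relabel_imp_Aut:
  assumes "hermitian A" "hermitian B" "graph_of A = graph_of B"
    and "bij f" "switching_equivalent \<Gamma> A (relabel f B)"
  shows "f \<in> carrier (Aut (graph_of A))"
proof -
  have "A $ u $ v = 0 \<longleftrightarrow> B $ f u $ f v = 0" for u v
    using switching_equivalent_zero_iff[OF assms(5)] by (simp add: relabel_def)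
  moreover have "A $ u $ v = 0 \<longleftrightarrow> B $ u $ v = 0" for u v
    using assms(3) graph_of_eq_iff[OF assms(1,2)] by blast
  ultimately show ?thesis
    using assms(4) by (simp add: carrier_Aut_graph_of[OF assms(1)])
qed

lemma switching_class_eq_iff:
  assumes "gain_set \<Gamma>" "X \<in> same_graph \<Gamma> A"
  shows "switching_class \<Gamma> A X = switching_class \<Gamma> A Y \<longleftrightarrow> switching_equivalent \<Gamma> X Y"
proof
  assume "switching_class \<Gamma> A X = switching_class \<Gamma> A Y"
  moreover have "X \<in> switching_class \<Gamma> A X"
    using assms by (simp add: switching_class_def switching_equivalent_refl)
  ultimately show "switching_equivalent \<Gamma> X Y"
    by (simp add: switching_class_def)
qed (rule switching_class_eq[OF assms(1)])

lemma (in group_action) same_orbit_iff: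
  assumes "x \<in> E" "y \<in> E"
  shows "(\<exists>orb \<in> orbits G E \<phi>. x \<in> orb \<and> y \<in> orb) \<longleftrightarrow> (\<exists>g \<in> carrier G. x = \<phi> g y)"
proof
  assume "\<exists>orb \<in> orbits G E \<phi>. x \<in> orb \<and> y \<in> orb"
  then obtain z where z: "z \<in> E" "x \<in> orbit G \<phi> z" "y \<in> orbit G \<phi> z"
    by (auto simp: orbits_def)
  then have "x \<in> orbit G \<phi> y"
    using orbit_sym orbit_trans assms by metis
  then show "\<exists>g \<in> carrier G. x = \<phi> g y"
    by (auto simp: orbit_def)
next
  assume "\<exists>g \<in> carrier G. x = \<phi> g y"
  then have "x \<in> orbit G \<phi> y"
    by (auto simp: orbit_def)
  then show "\<exists>orb \<in> orbits G E \<phi>. x \<in> orb \<and> y \<in> orb"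
    using orbit_refl assms by (auto simp: orbits_def)
qed

theorem theorem5p2:
  fixes \<Gamma> :: "complex set" and A B :: "complex^'n^'n"
  assumes "gain_set \<Gamma>"
    and "A \<in> Herm \<Gamma>" and "B \<in> Herm \<Gamma>"
    and "B \<in> same_graph \<Gamma> A"
  shows "switching_isomorphic \<Gamma> A B \<longleftrightarrow>
    (\<exists>orb \<in> orbits (Aut (graph_of A)) (switching_classes \<Gamma> A) (class_action \<Gamma> A).
       switching_class \<Gamma> A A \<in> orb \<and> switching_class \<Gamma> A B \<in> orb)"
    (is "_ \<longleftrightarrow> ?same_orbit")
proof -
  let ?Aut = "carrier (Aut (graph_of A))"
  interpret group_action "Aut (graph_of A)" "switching_classes \<Gamma> A" "class_action \<Gamma> A"
    using group_action_class_action[OF assms(1,2)] .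
  have h: "hermitian A" "hermitian B" "graph_of A = graph_of B"
    using assms(2-4) by (auto simp: Herm_def same_graph_def)
  have A: "A \<in> same_graph \<Gamma> A"
    using assms(2) by (simp add: same_graph_def)
  have "?same_orbit \<longleftrightarrow>
      (\<exists>f \<in> ?Aut. switching_class \<Gamma> A A = class_action \<Gamma> A f (switching_class \<Gamma> A B))"
    using A assms(4) by (intro same_orbit_iff) (simp_all add: switching_classes_def)
  also have "\<dots> \<longleftrightarrow> (\<exists>f \<in> ?Aut. switching_equivalent \<Gamma> A (relabel f B))"
    by (simp add: class_action_eq[OF assms(1,4)] switching_class_eq_iff[OF assms(1) A])
  also have "\<dots> \<longleftrightarrow> (\<exists>f. bij f \<and> switching_equivalent \<Gamma> A (relabel f B))"
    using switching_equivalent_relabel_imp_Aut[OF h] carrier_Aut_graph_of[OF h(1)] by blast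
  also have "\<dots> \<longleftrightarrow> switching_isomorphic \<Gamma> A B"
    using switching_isomorphic_iff_relabel[OF assms(2)] by blast
  finally show ?thesis
    by blast
qed

end
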